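(* For each positive integer $k$, let $$M_k=\begin{pmatrix} I_k & \frac1k J_k\\ \frac1k J_k & I_k\end{pmatrix}\in\mathbb{R}^{2k\times 2k},$$ where $I_k$ is the $k\times k$ identity matrix and $J_k$ is the $k\times k$ all-ones matrix. Then $\operatorname{cpsd-rank}_{\mathbb{C}}(M_k)=k$. Moreover, $\operatorname{cpsd-rank}_{\mathbb{R}}(M_k)=k$ if and only if there exists a real Hadamard matrix of order $k$.
   Context: For $X,Y\in\mathbb{C}^{d\times d}$ write $\langle X,Y\rangle=\mathrm{Tr}(X^*Y)$. A real symmetric $n\times n$ matrix $M$ is completely positive semidefinite if, for some $d$, there exist (real symmetric or complex Hermitian) positive semidefinite $d\times d$ matrices $X_1,\ldots,X_n$ with $M_{i,j}=\langle X_i,X_j\rangle$ for all $i,j$. For such $M$, $\operatorname{cpsd-rank}_{\mathbb{C}}(M)$ (respectively $\operatorname{cpsd-rank}_{\mathbb{R}}(M)$) is the smallest $d$ for which such $X_1,\ldots,X_n$ exist that are complex Hermitian (respectively real symmetric) positive semidefinite $d\times d$ matrices. A real Hadamard matrix of order $k$ is a $k\times k$ matrix with entries in $\{-1,1\}$ and pairwise orthogonal columns. *)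

theory Defs
  imports
    "Jordan_Normal_Form.Schur_Decomposition"
    "HOL-Library.Extended_Nat"
begin

definition mat_trace :: "'a :: comm_monoid_add mat \<Rightarrow> 'a" where
  "mat_trace A = (\<Sum>i<dim_row A. A $$ (i, i))"

definition trace_inner :: "'a :: conjugatable_field mat \<Rightarrow> 'a mat \<Rightarrow> 'a" where
  "trace_inner X Y = mat_trace (mat_adjoint X * Y)"

text \<open>
  Used over the complex and the real numbers. Over the reals \<open>conjugate\<close> is the identity, so
  \<open>mat_adjoint X = X\<close> says that \<open>X\<close> is symmetric. Over the complex numbers \<open>0 \<le> z\<close> means that
  \<open>z\<close> is real and nonnegative.
\<close>

definition psd_mat :: "nat \<Rightarrow> 'a :: conjugatable_ordered_field mat \<Rightarrow> bool" where
  "psd_mat d X \<longleftrightarrow> X \<in> carrier_mat d d \<and> mat_adjoint X = X \<and>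
     (\<forall>v \<in> carrier_vec d. 0 \<le> (X *\<^sub>v v) \<bullet>c v)"

definition psd_factorization ::
    "real mat \<Rightarrow> nat \<Rightarrow> (nat \<Rightarrow> 'a :: {conjugatable_ordered_field, real_algebra_1} mat) \<Rightarrow> bool" where
  "psd_factorization M d X \<longleftrightarrow> square_mat M \<and>
     (\<forall>i < dim_row M. psd_mat d (X i)) \<and>
     (\<forall>i < dim_row M. \<forall>j < dim_row M. of_real (M $$ (i, j)) = trace_inner (X i) (X j))"

text \<open>
  The infimum in \<^typ>\<open>enat\<close> is the least \<open>d\<close> if there is one and \<open>\<infinity>\<close> otherwise. Hence a finite
  value of either rank entails that \<open>M\<close> is completely positive semidefinite.
\<close>

definition cpsd_rank_complex :: "real mat \<Rightarrow> enat" where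
  "cpsd_rank_complex M =
     Inf {enat d | d. \<exists>X :: nat \<Rightarrow> complex mat. psd_factorization M d X}"

definition cpsd_rank_real :: "real mat \<Rightarrow> enat" where
  "cpsd_rank_real M =
     Inf {enat d | d. \<exists>X :: nat \<Rightarrow> real mat. psd_factorization M d X}"

definition hadamard_mat :: "nat \<Rightarrow> real mat \<Rightarrow> bool" where
  "hadamard_mat k H \<longleftrightarrow> H \<in> carrier_mat k k \<and>
     (\<forall>i < k. \<forall>j < k. H $$ (i, j) \<in> {-1, 1}) \<and>
     (\<forall>i < k. \<forall>j < k. i \<noteq> j \<longrightarrow> col H i \<bullet> col H j = 0)"

definition all_ones_mat :: "nat \<Rightarrow> real mat" where
  "all_ones_mat k = mat k k (\<lambda>_. 1)"

definition M_mat :: "nat \<Rightarrow> real mat" where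
  "M_mat k = four_block_mat
     (1\<^sub>m k) ((1 / real k) \<cdot>\<^sub>m all_ones_mat k)
     ((1 / real k) \<cdot>\<^sub>m all_ones_mat k) (1\<^sub>m k)"

end

theory Submission
  imports Defs
begin

text \<open>
  Two positive semidefinite matrices with trace inner product zero annihilate each other. In a
  factorization of \<^term>\<open>M_mat k\<close> the first \<open>k\<close> factors \<open>X\<^sub>i\<close> are orthonormal, so nonzero
  vectors \<open>x\<^sub>i\<close> chosen in their ranges are pairwise orthogonal
  (\<open>psd_orthogonal_range_vectors\<close>). Since \<open>k\<close> orthogonal nonzero vectors need a space of
  dimension at least \<open>k\<close>, both ranks are at least \<open>k\<close>.

  If the dimension equals \<open>k\<close>, the \<open>x\<^sub>i\<close> form an orthogonal basis, and \<open>X\<^sub>i\<close> vanishes on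
  every \<open>x\<^sub>j\<close> with \<open>j \<noteq> i\<close>. Hence \<open>X\<^sub>i\<close> has rank one, and over the reals it is
  \<open>x\<^sub>i x\<^sub>i\<^sup>T\<close> for an orthonormal basis after rescaling (\<open>psd_orthonormal_rank_one\<close>). The same
  holds for the last \<open>k\<close> factors, with an orthonormal basis \<open>y\<^sub>j\<close>. The off-diagonal blocks say
  \<open>(x\<^sub>i \<bullet> y\<^sub>j)\<^sup>2 = 1/k\<close>: the bases are mutually unbiased. So \<open>\<surd>k (x\<^sub>i \<bullet> y\<^sub>j)\<close> is a
  matrix of signs, and it is \<open>\<surd>k\<close> times an orthogonal matrix, that is, a Hadamard matrix.

  Conversely, an orthonormal basis that is unbiased with respect to the standard basis gives a
  factorization of dimension \<open>k\<close> by rank-one projections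
  (\<open>psd_factorization_M_mat_unbiased_basis\<close>). Over the complex numbers the Fourier basis is one
  for every \<open>k\<close>; over the reals the normalized columns of a Hadamard matrix are one.

  Annihilation and the lower bound are proved for real and complex matrices at once, over a field
  with a conjugation and a possibly partial order, and without eigenvalues or square roots:
  rank-one matrices are subtracted instead of diagonalizing (\<open>psd_deflation\<close>).
\<close>

section \<open>Conjugation, adjoints and rank-one matrices\<close>

lemma conjugate_one_field [simp]: "conjugate (1 :: 'a :: conjugatable_field) = 1"
proof -
  have "conjugate (1 :: 'a) * conjugate 1 = conjugate 1 * 1"
    by (metis conjugate_dist_mul mult_1_right)
  thus ?thesis
    by (metis conjugate_zero_iff mult_cancel_left zero_neq_one)
qed

lemma conjugate_inverse_field:
  "conjugate (inverse (c :: 'a :: conjugatable_field)) = inverse (conjugate c)"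
proof (cases "c = 0")
  case False
  hence "conjugate c * conjugate (inverse c) = 1"
    by (simp flip: conjugate_dist_mul)
  thus ?thesis by (metis inverse_unique)
qed simp

lemma conjugate_unit_vec [simp]:
  "conjugate (unit_vec n i) = (unit_vec n i :: 'a :: conjugatable_field vec)"
  by (rule eq_vecI) (auto simp: unit_vec_def)

lemma zero_mult_mat_vec:
  "v \<in> carrier_vec m \<Longrightarrow> 0\<^sub>m n m *\<^sub>v v = (0\<^sub>v n :: 'a :: semiring_0 vec)"
  by (intro eq_vecI) auto

lemma smult_mat_mult_vec:
  "A \<in> carrier_mat n m \<Longrightarrow> v \<in> carrier_vec m \<Longrightarrow>
    (c \<cdot>\<^sub>m A) *\<^sub>v v = c \<cdot>\<^sub>v (A *\<^sub>v (v :: 'a :: comm_ring vec))"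
  by (intro eq_vecI) auto

lemma cscalar_conj:
  fixes u v :: "'a :: conjugatable_field vec"
  assumes "u \<in> carrier_vec d" "v \<in> carrier_vec d"
  shows "conjugate (u \<bullet>c v) = v \<bullet>c u"
proof -
  have "conjugate (u \<bullet>c v) = conjugate u \<bullet> v"
    using conjugate_sprod_vec[of u d "conjugate v"] assms by simp
  thus ?thesis using conjugate_vec_sprod_comm[OF assms(2,1)] by simp
qed

lemma mat_adjoint_carrier: "A \<in> carrier_mat n m \<Longrightarrow> mat_adjoint A \<in> carrier_mat m n"
  by (auto simp: mat_adjoint_def)

lemma mat_adjoint_index:
  "A \<in> carrier_mat n m \<Longrightarrow> i < m \<Longrightarrow> j < n \<Longrightarrow> mat_adjoint A $$ (i, j) = conjugate (A $$ (j, i))"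
  by (auto simp: mat_adjoint_def mat_of_rows_def)

lemma self_adjointI:
  assumes "A \<in> carrier_mat d d"
    and "\<And>a b. a < d \<Longrightarrow> b < d \<Longrightarrow> conjugate (A $$ (b, a)) = A $$ (a, b)"
  shows "mat_adjoint A = A"
  using assms mat_adjoint_carrier[OF assms(1)] by (intro eq_matI) (auto simp: mat_adjoint_index)

lemma self_adjoint_index:
  assumes "A \<in> carrier_mat d d" "mat_adjoint A = A" "a < d" "b < d"
  shows "conjugate (A $$ (b, a)) = A $$ (a, b)"
  using mat_adjoint_index[OF assms(1,3,4)] assms(2) by simp

lemma self_adjoint_cscalar:
  fixes A :: "'a :: conjugatable_field mat"
  assumes A: "A \<in> carrier_mat d d" "mat_adjoint A = A"
    and u: "u \<in> carrier_vec d" and v: "v \<in> carrier_vec d"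
  shows "(A *\<^sub>v u) \<bullet>c v = u \<bullet>c (A *\<^sub>v v)"
proof -
  have "(A *\<^sub>v u) \<bullet>c v = (\<Sum>a<d. \<Sum>b<d. A $$ (a, b) * u $ b * conjugate (v $ a))"
    using A u v by (simp add: scalar_prod_def sum_distrib_right lessThan_atLeast0)
  also have "\<dots> = (\<Sum>b<d. \<Sum>a<d. A $$ (a, b) * u $ b * conjugate (v $ a))"
    by (rule sum.swap)
  also have "\<dots> = (\<Sum>b<d. \<Sum>a<d. u $ b * conjugate (A $$ (b, a) * v $ a))"
    by (intro sum.cong refl)
      (simp add: conjugate_dist_mul self_adjoint_index[OF A] mult_ac)
  also have "\<dots> = u \<bullet>c (A *\<^sub>v v)"
    using A u v
    by (simp add: scalar_prod_def sum_distrib_left lessThan_atLeast0 sum_conjugate)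
  finally show ?thesis .
qed

text \<open>
  The matrix \<open>v v\<^sup>*\<close>, a multiple of the orthogonal projection onto the line of \<open>v\<close>.
\<close>

definition outer :: "'a :: conjugatable_field vec \<Rightarrow> 'a mat" where
  "outer v = mat (dim_vec v) (dim_vec v) (\<lambda>(a, b). v $ a * conjugate (v $ b))"

lemma outer_carrier [simp]: "v \<in> carrier_vec d \<Longrightarrow> outer v \<in> carrier_mat d d"
  by (auto simp: outer_def)

lemma outer_dim [simp]: "dim_row (outer v) = dim_vec v" "dim_col (outer v) = dim_vec v"
  by (simp_all add: outer_def)

lemma outer_index [simp]:
  "v \<in> carrier_vec d \<Longrightarrow> a < d \<Longrightarrow> b < d \<Longrightarrow> outer v $$ (a, b) = v $ a * conjugate (v $ b)"
  by (auto simp: outer_def)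

lemma outer_mult_vec:
  fixes u v :: "'a :: conjugatable_field vec"
  assumes u: "u \<in> carrier_vec d" and v: "v \<in> carrier_vec d"
  shows "outer u *\<^sub>v v = (v \<bullet>c u) \<cdot>\<^sub>v u"
proof (rule eq_vecI)
  fix a assume "a < dim_vec ((v \<bullet>c u) \<cdot>\<^sub>v u)"
  thus "(outer u *\<^sub>v v) $ a = ((v \<bullet>c u) \<cdot>\<^sub>v u) $ a"
    using u v by (auto simp: outer_def scalar_prod_def sum_distrib_right sum_distrib_left
        mult_ac intro!: sum.cong)
qed (use u in \<open>auto simp: outer_def\<close>)

lemma outer_adjoint: "u \<in> carrier_vec d \<Longrightarrow> mat_adjoint (outer u) = outer u"
  by (rule self_adjointI[of _ d]) (auto simp: conjugate_dist_mul mult_ac)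

lemma psd_mat_outer:
  assumes u: "u \<in> carrier_vec d"
  shows "psd_mat d (outer (u :: 'a :: conjugatable_ordered_field vec))"
  unfolding psd_mat_def
proof (intro conjI ballI)
  fix v :: "'a vec" assume v: "v \<in> carrier_vec d"
  have "(outer u *\<^sub>v v) \<bullet>c v = (v \<bullet>c u) * conjugate (v \<bullet>c u)"
    using u v by (simp add: outer_mult_vec[OF u v] cscalar_conj[OF v u])
  thus "0 \<le> (outer u *\<^sub>v v) \<bullet>c v"
    using conjugate_square_positive by simp
qed (use u in \<open>auto simp: outer_adjoint\<close>)

lemma mat_trace_mult:
  "A \<in> carrier_mat d d \<Longrightarrow> B \<in> carrier_mat d d \<Longrightarrow>
    mat_trace (A * B) = (\<Sum>a<d. \<Sum>b<d. A $$ (a, b) * B $$ (b, a))"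
  by (simp add: mat_trace_def scalar_prod_def lessThan_atLeast0)

lemma mat_trace_outer_mult:
  fixes B :: "'a :: conjugatable_field mat"
  assumes u: "u \<in> carrier_vec d" and B: "B \<in> carrier_mat d d"
  shows "mat_trace (outer u * B) = (B *\<^sub>v u) \<bullet>c u"
proof -
  have "mat_trace (outer u * B) = (\<Sum>a<d. \<Sum>b<d. u $ a * conjugate (u $ b) * B $$ (b, a))"
    using u by (simp add: mat_trace_mult[OF outer_carrier[OF u] B])
  also have "\<dots> = (\<Sum>b<d. \<Sum>a<d. u $ a * conjugate (u $ b) * B $$ (b, a))"
    by (rule sum.swap)
  also have "\<dots> = (B *\<^sub>v u) \<bullet>c u"
    using u B by (simp add: scalar_prod_def lessThan_atLeast0 sum_distrib_left mult_ac)
  finally show ?thesis .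
qed

lemma trace_inner_outer:
  fixes u v :: "'a :: conjugatable_field vec"
  assumes u: "u \<in> carrier_vec d" and v: "v \<in> carrier_vec d"
  shows "trace_inner (outer u) (outer v) = (u \<bullet>c v) * conjugate (u \<bullet>c v)"
  using u v
  by (simp add: trace_inner_def outer_adjoint mat_trace_outer_mult outer_mult_vec cscalar_conj[OF u v])

section \<open>Positive semidefinite matrices\<close>

lemma psd_matD:
  assumes "psd_mat d X"
  shows "X \<in> carrier_mat d d" "mat_adjoint X = X"
    "\<And>v. v \<in> carrier_vec d \<Longrightarrow> 0 \<le> (X *\<^sub>v v) \<bullet>c v"
  using assms by (auto simp: psd_mat_def)

lemma form_combination:
  fixes X :: "'a :: conjugatable_field mat"
  assumes c: "X \<in> carrier_mat d d" and u: "u \<in> carrier_vec d" and v: "v \<in> carrier_vec d"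
  shows "(X *\<^sub>v (r \<cdot>\<^sub>v v - s \<cdot>\<^sub>v u)) \<bullet>c (r \<cdot>\<^sub>v v - s \<cdot>\<^sub>v u) =
    r * conjugate r * ((X *\<^sub>v v) \<bullet>c v) - r * conjugate s * ((X *\<^sub>v v) \<bullet>c u)
    - s * conjugate r * ((X *\<^sub>v u) \<bullet>c v) + s * conjugate s * ((X *\<^sub>v u) \<bullet>c u)"
proof -
  have conj: "conjugate (r \<cdot>\<^sub>v v - s \<cdot>\<^sub>v u) = conjugate r \<cdot>\<^sub>v conjugate v - conjugate s \<cdot>\<^sub>v conjugate u"
  proof (rule eq_vecI)
    fix i assume "i < dim_vec (conjugate r \<cdot>\<^sub>v conjugate v - conjugate s \<cdot>\<^sub>v conjugate u)"
    with u v show "conjugate (r \<cdot>\<^sub>v v - s \<cdot>\<^sub>v u) $ i =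
        (conjugate r \<cdot>\<^sub>v conjugate v - conjugate s \<cdot>\<^sub>v conjugate u) $ i"
      by (simp add: diff_conv_add_uminus conjugate_dist_add conjugate_dist_mul conjugate_neg
          del: add_uminus_conv_diff)
  qed (use u v in auto)
  have Xw: "X *\<^sub>v (r \<cdot>\<^sub>v v - s \<cdot>\<^sub>v u) = r \<cdot>\<^sub>v (X *\<^sub>v v) - s \<cdot>\<^sub>v (X *\<^sub>v u)"
    using c u v by (simp add: mult_minus_distrib_mat_vec mult_mat_vec)
  show ?thesis
    unfolding conj Xw using c u v
    by (simp add: minus_scalar_prod_distrib[of _ d] scalar_prod_minus_distrib[of _ d] algebra_simps)
qed

text \<open>
  With \<open>u = X v\<close>, the form on the line \<open>v - s u\<close> has derivative \<open>-2 (u \<bullet>c u)\<close> at \<open>s = 0\<close>, so it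
  would become negative for small positive \<open>s\<close> if \<open>u\<close> were nonzero. A suitable value is
  \<open>s = n / (q + n)\<close>, where \<open>n = u \<bullet>c u\<close> and \<open>q\<close> is the value of the form at \<open>u\<close>; the proof
  takes the vector cleared of this denominator.
\<close>

lemma psd_form_eq_0D:
  fixes X :: "'a :: {conjugatable_ordered_field, ordered_comm_ring} mat"
  assumes X: "psd_mat d X" and v: "v \<in> carrier_vec d" and z: "(X *\<^sub>v v) \<bullet>c v = 0"
  shows "X *\<^sub>v v = 0\<^sub>v d"
proof -
  define u where "u = X *\<^sub>v v"
  note c = psd_matD(1,2)[OF X]
  have u: "u \<in> carrier_vec d" using c v by (simp add: u_def)
  define n where "n = u \<bullet>c u"
  define q where "q = (X *\<^sub>v u) \<bullet>c u"
  have n: "0 \<le> n" by (auto simp: n_def)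
  have q: "0 \<le> q" using psd_matD(3)[OF X u] by (simp add: q_def)
  have cn: "conjugate n = n" using cscalar_conj[OF u u] by (simp add: n_def)
  have cq: "conjugate q = q"
    using cscalar_conj[of "X *\<^sub>v u" d u] c u self_adjoint_cscalar[OF c u u] by (simp add: q_def)
  have un: "(X *\<^sub>v u) \<bullet>c v = n"
    using self_adjoint_cscalar[OF c u v] by (simp add: n_def u_def)
  let ?w = "(q + n) \<cdot>\<^sub>v v - n \<cdot>\<^sub>v u"
  have "0 \<le> (X *\<^sub>v ?w) \<bullet>c ?w"
    using u v by (intro psd_matD(3)[OF X]) auto
  also have "(X *\<^sub>v ?w) \<bullet>c ?w = - (n * n * q + n * n * n + n * n * n)"
    using z un unfolding form_combination[OF c(1) u v]
    by (simp add: cn cq conjugate_dist_add algebra_simps flip: u_def n_def q_def)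
  finally have "n * n * q + n * n * n + n * n * n \<le> 0"
    by (simp only: neg_0_le_iff_le)
  moreover have "0 \<le> n * n * q" "0 \<le> n * n * n"
    using n q by auto
  ultimately have "n * n * n = 0"
    by (metis add_nonneg_eq_0_iff add_nonneg_nonneg order_antisym)
  hence "u \<bullet>c u = 0" by (simp add: n_def)
  thus ?thesis using u by (simp add: u_def)
qed

text \<open>
  One step of the Cholesky decomposition. The form of the new matrix at \<open>v\<close> is the form of \<open>X\<close> at
  the component of \<open>v\<close> that is orthogonal to \<open>e\<close> with respect to \<open>X\<close>, hence nonnegative.
\<close>

lemma psd_deflation:
  fixes X :: "'a :: {conjugatable_ordered_field, ordered_comm_ring} mat"
  assumes X: "psd_mat d X" and e: "e \<in> carrier_vec d" and p: "p = (X *\<^sub>v e) \<bullet>c e" "p \<noteq> 0"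
  shows "psd_mat d (X - inverse p \<cdot>\<^sub>m outer (X *\<^sub>v e))"
proof -
  note c = psd_matD(1,2)[OF X]
  define x where "x = X *\<^sub>v e"
  have x: "x \<in> carrier_vec d" using c e by (simp add: x_def)
  have cp: "conjugate p = p"
    using cscalar_conj[of "X *\<^sub>v e" d e] c e self_adjoint_cscalar[OF c e e] by (simp add: p)
  hence ct: "conjugate (inverse p) = inverse p" by (simp add: conjugate_inverse_field)
  let ?X = "X - inverse p \<cdot>\<^sub>m outer x"
  have "psd_mat d ?X"
    unfolding psd_mat_def
  proof (intro conjI ballI)
    show "?X \<in> carrier_mat d d" using c x
      by (intro minus_carrier_mat smult_carrier_mat outer_carrier)
    show "mat_adjoint ?X = ?X"
    proof (rule self_adjointI)
      fix a b assume ab: "a < d" "b < d"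
      have idx: "?X $$ (a, b) = X $$ (a, b) + - (inverse p * (x $ a * conjugate (x $ b)))"
        if "a < d" "b < d" for a b
        using that c x outer_carrier[OF x] by simp
      show "conjugate (?X $$ (b, a)) = ?X $$ (a, b)"
        unfolding idx[OF ab] idx[OF ab(2,1)]
        by (simp add: conjugate_dist_add conjugate_dist_mul conjugate_neg ct mult_ac
            self_adjoint_index[OF c ab] del: add_uminus_conv_diff)
    qed (use c x in \<open>intro minus_carrier_mat smult_carrier_mat outer_carrier\<close>)
    fix v :: "'a vec" assume v: "v \<in> carrier_vec d"
    define \<alpha> where "\<alpha> = v \<bullet>c x"
    have a1: "(X *\<^sub>v v) \<bullet>c e = \<alpha>"
      using self_adjoint_cscalar[OF c v e] by (simp add: \<alpha>_def x_def)
    have a2: "x \<bullet>c v = conjugate \<alpha>"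
      using cscalar_conj[OF v x] by (simp add: \<alpha>_def)
    \<comment> \<open>The component of \<open>v\<close> that is orthogonal to \<open>e\<close> in the form of \<open>X\<close>.\<close>
    let ?w = "1 \<cdot>\<^sub>v v - (inverse p * \<alpha>) \<cdot>\<^sub>v e"
    have "0 \<le> (X *\<^sub>v ?w) \<bullet>c ?w"
      using e v by (intro psd_matD(3)[OF X]) auto
    also have "(X *\<^sub>v ?w) \<bullet>c ?w = (X *\<^sub>v v) \<bullet>c v - inverse p * \<alpha> * conjugate \<alpha>"
      using p(2) unfolding form_combination[OF c(1) e v]
      by (simp add: a1 a2 ct conjugate_dist_mul field_simps flip: x_def p(1)[folded x_def])
    also have "\<dots> = (?X *\<^sub>v v) \<bullet>c v"
    proof -
      have "?X *\<^sub>v v = X *\<^sub>v v - inverse p \<cdot>\<^sub>v (\<alpha> \<cdot>\<^sub>v x)"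
        using c x v outer_carrier[OF x] outer_mult_vec[OF x v]
        by (simp add: minus_mult_distrib_mat_vec[of _ d d] \<alpha>_def smult_mat_mult_vec[of _ d d])
      thus ?thesis using c x v a2
        by (simp add: minus_scalar_prod_distrib[of _ d])
    qed
    finally show "0 \<le> (?X *\<^sub>v v) \<bullet>c v" .
  qed
  thus ?thesis by (simp add: x_def)
qed

lemma form_unit_vec:
  assumes "X \<in> carrier_mat d d" "i < d"
  shows "(X *\<^sub>v unit_vec d i) \<bullet>c unit_vec d i = (X $$ (i, i) :: 'a :: conjugatable_field)"
  using assms by simp

lemma psd_zero_diag:
  fixes X :: "'a :: {conjugatable_ordered_field, ordered_comm_ring} mat"
  assumes X: "psd_mat d X" and z: "\<And>i. i < d \<Longrightarrow> X $$ (i, i) = 0"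
  shows "X = 0\<^sub>m d d"
proof (rule eq_matI)
  note c = psd_matD(1,2)[OF X]
  fix a b assume ab: "a < dim_row (0\<^sub>m d d :: 'a mat)" "b < dim_col (0\<^sub>m d d :: 'a mat)"
  hence "X *\<^sub>v unit_vec d b = 0\<^sub>v d"
    using c z by (intro psd_form_eq_0D[OF X]) (auto simp: form_unit_vec)
  from arg_cong[OF this, of "\<lambda>v. v $ a"] show "X $$ (a, b) = 0\<^sub>m d d $$ (a, b)"
    using c ab by simp
qed (use psd_matD(1)[OF X] in auto)

text \<open>
  The map \<open>X \<mapsto> Tr (X Y)\<close> is linear, and its value at \<open>x x\<^sup>*\<close> is the form of \<open>Y\<close> at \<open>x\<close>, which is
  nonnegative and vanishes only if \<open>Y x = 0\<close>. Deflation at a nonzero diagonal entry of \<open>X\<close> splits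
  off a nonnegative multiple of such an \<open>x x\<^sup>*\<close>. It clears that entry and keeps the zeros on the
  diagonal, so the number of nonzero diagonal entries decreases; when none is left, \<open>X = 0\<close>.
\<close>

lemma mat_trace_psd_mult:
  fixes X Y :: "'a :: {conjugatable_ordered_field, ordered_comm_ring} mat"
  assumes "psd_mat d X" and Y: "psd_mat d Y"
  shows "0 \<le> mat_trace (X * Y) \<and> (mat_trace (X * Y) = 0 \<longrightarrow> Y * X = 0\<^sub>m d d)"
  using assms(1)
proof (induction "card {i. i < d \<and> X $$ (i, i) \<noteq> 0}" arbitrary: X rule: less_induct)
  case less
  note X = less.prems
  note c = psd_matD(1,2)[OF X] and cY = psd_matD(1)[OF Y]
  show ?case
  proof (cases "\<exists>i<d. X $$ (i, i) \<noteq> 0")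
    case False
    hence "X = 0\<^sub>m d d" using psd_zero_diag[OF X] by blast
    thus ?thesis using cY by (simp add: mat_trace_def)
  next
    case True
    then obtain i where i: "i < d" "X $$ (i, i) \<noteq> 0" by blast
    define p where "p = X $$ (i, i)"
    define x where "x = X *\<^sub>v unit_vec d i"
    define X' where "X' = X - inverse p \<cdot>\<^sub>m outer x"
    have x: "x \<in> carrier_vec d" using c by (simp add: x_def)
    have xa: "x $ a = X $$ (a, i)" if "a < d" for a
      using c that i by (simp add: x_def)
    have "p \<noteq> 0" and p_form: "p = (X *\<^sub>v unit_vec d i) \<bullet>c unit_vec d i"
      using i c by (auto simp: p_def form_unit_vec)
    hence X': "psd_mat d X'"
      using psd_deflation[OF X _ p_form] by (simp add: X'_def x_def)
    have p0: "0 \<le> p" using psd_matD(3)[OF X, of "unit_vec d i"] p_form by simp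
    have cp: "conjugate p = p" using self_adjoint_index[OF c i(1) i(1)] by (simp add: p_def)
    \<comment> \<open>The order need not be linear; the inverse of \<open>p\<close> is nonnegative as \<open>p\<close> times a square.\<close>
    have "0 \<le> p * (inverse p * conjugate (inverse p))"
      using p0 conjugate_square_positive by (rule mult_nonneg_nonneg)
    hence t0: "0 \<le> inverse p"
      using \<open>p \<noteq> 0\<close> by (simp add: conjugate_inverse_field cp flip: mult.assoc)
    have diag: "X' $$ (a, a) = X $$ (a, a) - inverse p * (x $ a * conjugate (x $ a))" if "a < d" for a
      using c x outer_carrier[OF x] that by (simp add: X'_def)
    have "{a. a < d \<and> X' $$ (a, a) \<noteq> 0} \<subseteq> {a. a < d \<and> X $$ (a, a) \<noteq> 0}"
    proof safe
      fix a assume a: "a < d" "X' $$ (a, a) \<noteq> 0" "X $$ (a, a) = 0"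
      have "0 \<le> X' $$ (a, a)"
        using psd_matD(3)[OF X', of "unit_vec d a"] psd_matD(1)[OF X'] a by (simp add: form_unit_vec)
      moreover have "0 \<le> inverse p * (x $ a * conjugate (x $ a))"
        using t0 conjugate_square_positive by (rule mult_nonneg_nonneg)
      ultimately have "X' $$ (a, a) = 0" using diag[OF a(1)] a(3) by simp
      thus False using a by simp
    qed
    moreover have "X' $$ (i, i) = 0"
      using diag[OF i(1)] xa[OF i(1)] cp \<open>p \<noteq> 0\<close> by (simp add: p_def)
    ultimately have "{a. a < d \<and> X' $$ (a, a) \<noteq> 0} \<subset> {a. a < d \<and> X $$ (a, a) \<noteq> 0}"
      using i by blast
    hence "card {a. a < d \<and> X' $$ (a, a) \<noteq> 0} < card {a. a < d \<and> X $$ (a, a) \<noteq> 0}"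
      by (intro psubset_card_mono) auto
    from less.hyps[OF this X']
    have IH: "0 \<le> mat_trace (X' * Y)" "mat_trace (X' * Y) = 0 \<Longrightarrow> Y * X' = 0\<^sub>m d d"
      by auto
    note cX' = psd_matD(1)[OF X']
    have X_eq: "X = X' + inverse p \<cdot>\<^sub>m outer x"
      using c x outer_carrier[OF x] by (intro eq_matI) (auto simp: X'_def)
    have "mat_trace (X * Y) = mat_trace (X' * Y) + inverse p * mat_trace (outer x * Y)"
    proof -
      have "mat_trace (X * Y) = (\<Sum>a<d. \<Sum>b<d. (X' $$ (a, b) + inverse p * outer x $$ (a, b)) * Y $$ (b, a))"
        using c x outer_carrier[OF x] unfolding mat_trace_mult[OF c(1) cY]
        by (intro sum.cong refl) (simp add: X'_def)
      thus ?thesis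
        by (simp add: mat_trace_mult[OF cX' cY] mat_trace_mult[OF outer_carrier[OF x] cY]
            distrib_right sum.distrib sum_distrib_left mult.assoc)
    qed
    hence tr: "mat_trace (X * Y) = mat_trace (X' * Y) + inverse p * ((Y *\<^sub>v x) \<bullet>c x)"
      by (simp add: mat_trace_outer_mult[OF x cY])
    have nn: "0 \<le> inverse p * ((Y *\<^sub>v x) \<bullet>c x)"
      using t0 psd_matD(3)[OF Y x] by (rule mult_nonneg_nonneg)
    show ?thesis
    proof (intro conjI impI)
      show "0 \<le> mat_trace (X * Y)" using tr IH(1) nn by simp
      assume "mat_trace (X * Y) = 0"
      with tr IH(1) nn have "mat_trace (X' * Y) = 0" "inverse p * ((Y *\<^sub>v x) \<bullet>c x) = 0"
        by (simp_all add: add_nonneg_eq_0_iff)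
      hence YX': "Y * X' = 0\<^sub>m d d" and Yx: "Y *\<^sub>v x = 0\<^sub>v d"
        using IH(2) \<open>p \<noteq> 0\<close> psd_form_eq_0D[OF Y x] by auto
      have "Y * outer x = 0\<^sub>m d d"
      proof (rule eq_matI)
        fix a b assume ab: "a < dim_row (0\<^sub>m d d :: 'a mat)" "b < dim_col (0\<^sub>m d d :: 'a mat)"
        have "(Y * outer x) $$ (a, b) = (Y *\<^sub>v x) $ a * conjugate (x $ b)"
          using ab cY x outer_carrier[OF x]
          by (auto simp: scalar_prod_def sum_distrib_right mult.assoc intro!: sum.cong)
        thus "(Y * outer x) $$ (a, b) = 0\<^sub>m d d $$ (a, b)" using Yx ab by simp
      qed (use cY outer_carrier[OF x] in auto)
      thus "Y * X = 0\<^sub>m d d"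
        using YX' cY cX' outer_carrier[OF x]
        by (simp add: X_eq mult_add_distrib_mat[of _ d d] mult_smult_distrib[of _ d d])
    qed
  qed
qed

section \<open>Orthogonal families of vectors\<close>

text \<open>
  If \<open>d < k\<close>, padding with zeros makes both matrices square of order \<open>k\<close> and keeps \<open>Q P = 1\<close>.
  A left inverse of a square matrix is a right inverse, but \<open>P\<close> now has a zero row.
\<close>

lemma left_inverse_dim_le:
  fixes P Q :: "'a :: field mat"
  assumes P: "P \<in> carrier_mat d k" and Q: "Q \<in> carrier_mat k d" and QP: "Q * P = 1\<^sub>m k"
  shows "k \<le> d"
proof (rule ccontr)
  assume "\<not> k \<le> d"
  hence dk: "d < k" by simp
  define P' where "P' = mat k k (\<lambda>(i, j). if i < d then P $$ (i, j) else 0)"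
  define Q' where "Q' = mat k k (\<lambda>(i, j). if j < d then Q $$ (i, j) else 0)"
  have "Q' * P' = 1\<^sub>m k"
  proof (rule eq_matI)
    fix i j assume "i < dim_row (1\<^sub>m k :: 'a mat)" "j < dim_col (1\<^sub>m k :: 'a mat)"
    hence ij: "i < k" "j < k" by auto
    have "(Q' * P') $$ (i, j) = (\<Sum>l<k. if l < d then Q $$ (i, l) * P $$ (l, j) else 0)"
      using ij by (auto simp: P'_def Q'_def scalar_prod_def lessThan_atLeast0 intro!: sum.cong)
    also have "\<dots> = (\<Sum>l<d. Q $$ (i, l) * P $$ (l, j))"
      using dk by (intro sum.mono_neutral_cong_right) auto
    also have "\<dots> = (Q * P) $$ (i, j)"
      using ij P Q by (simp add: scalar_prod_def lessThan_atLeast0)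
    finally show "(Q' * P') $$ (i, j) = 1\<^sub>m k $$ (i, j)" by (simp add: QP)
  qed (auto simp: P'_def Q'_def)
  hence "P' * Q' = 1\<^sub>m k"
    by (intro mat_mult_left_right_inverse[of Q' k P']) (auto simp: P'_def Q'_def)
  moreover have "(P' * Q') $$ (d, d) = 0"
    using dk by (auto simp: P'_def Q'_def scalar_prod_def intro!: sum.neutral)
  ultimately show False using dk by simp
qed

text \<open>
  Row \<open>i\<close> is the linear functional that reads off the coordinate along \<open>x i\<close> of a vector in the
  span of the orthogonal family \<open>x\<close>.
\<close>

definition dual_rows :: "nat \<Rightarrow> nat \<Rightarrow> (nat \<Rightarrow> 'a :: conjugatable_field vec) \<Rightarrow> 'a mat" where
  "dual_rows d k x = mat k d (\<lambda>(i, a). conjugate (x i $ a) / (x i \<bullet>c x i))"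

lemma dual_rows_left_inverse:
  fixes x :: "nat \<Rightarrow> 'a :: conjugatable_field vec"
  assumes x: "\<And>i. i < k \<Longrightarrow> x i \<in> carrier_vec d"
    and orth: "\<And>i j. i < k \<Longrightarrow> j < k \<Longrightarrow> x i \<bullet>c x j = 0 \<longleftrightarrow> i \<noteq> j"
  shows "dual_rows d k x * mat d k (\<lambda>(a, j). x j $ a) = 1\<^sub>m k"
proof (rule eq_matI)
  fix i j assume "i < dim_row (1\<^sub>m k :: 'a mat)" "j < dim_col (1\<^sub>m k :: 'a mat)"
  hence ij: "i < k" "j < k" by auto
  have "(dual_rows d k x * mat d k (\<lambda>(a, j). x j $ a)) $$ (i, j) =
      (\<Sum>a<d. x j $ a * conjugate (x i $ a)) / (x i \<bullet>c x i)"
    using ij by (simp add: dual_rows_def scalar_prod_def lessThan_atLeast0 sum_divide_distrib mult_ac)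
  also have "(\<Sum>a<d. x j $ a * conjugate (x i $ a)) = x j \<bullet>c x i"
    using x[OF ij(1)] by (simp add: scalar_prod_def lessThan_atLeast0)
  finally show "(dual_rows d k x * mat d k (\<lambda>(a, j). x j $ a)) $$ (i, j) = 1\<^sub>m k $$ (i, j)"
    using ij orth by auto
qed (auto simp: dual_rows_def)

lemma orthogonal_family_card_le:
  fixes x :: "nat \<Rightarrow> 'a :: conjugatable_field vec"
  assumes "\<And>i. i < k \<Longrightarrow> x i \<in> carrier_vec d"
    and "\<And>i j. i < k \<Longrightarrow> j < k \<Longrightarrow> x i \<bullet>c x j = 0 \<longleftrightarrow> i \<noteq> j"
  shows "k \<le> d"
  by (rule left_inverse_dim_le[OF _ _ dual_rows_left_inverse[of k x d, OF assms]])
    (auto simp: dual_rows_def)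

text \<open>
  An orthogonal family of full size \<open>d\<close> is a basis: its dual rows are a left, hence a right inverse
  of the square matrix with columns \<open>x i\<close>.
\<close>

lemma parseval:
  fixes x :: "nat \<Rightarrow> 'a :: conjugatable_field vec"
  assumes x: "\<And>i. i < d \<Longrightarrow> x i \<in> carrier_vec d"
    and orth: "\<And>i j. i < d \<Longrightarrow> j < d \<Longrightarrow> x i \<bullet>c x j = 0 \<longleftrightarrow> i \<noteq> j"
    and u: "u \<in> carrier_vec d" and w: "w \<in> carrier_vec d"
  shows "u \<bullet>c w = (\<Sum>i<d. (u \<bullet>c x i) * (x i \<bullet>c w) / (x i \<bullet>c x i))"
proof -
  define P where "P = mat d d (\<lambda>(a, j). x j $ a)"
  have P: "P \<in> carrier_mat d d" and Q: "dual_rows d d x \<in> carrier_mat d d"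
    by (auto simp: P_def dual_rows_def)
  have inv: "P * dual_rows d d x = 1\<^sub>m d"
    using dual_rows_left_inverse[of d x d, OF x orth]
    by (intro mat_mult_left_right_inverse[OF Q P]) (simp add: P_def)
  have coord: "(dual_rows d d x *\<^sub>v u) $ i = (u \<bullet>c x i) / (x i \<bullet>c x i)" if "i < d" for i
    using that u x[OF that]
    by (simp add: dual_rows_def scalar_prod_def sum_divide_distrib mult_ac)
  have "u = P *\<^sub>v (dual_rows d d x *\<^sub>v u)"
    using assoc_mult_mat_vec[OF P Q u] inv u by simp
  hence "u \<bullet>c w = (P *\<^sub>v (dual_rows d d x *\<^sub>v u)) \<bullet>c w" by simp
  also have "\<dots> = (\<Sum>a<d. \<Sum>i<d. x i $ a * ((u \<bullet>c x i) / (x i \<bullet>c x i)) * conjugate (w $ a))"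
    using w P Q coord
    by (simp add: scalar_prod_def[of _ "conjugate w"] lessThan_atLeast0 sum_distrib_right)
      (simp add: scalar_prod_def P_def sum_distrib_right)
  also have "\<dots> = (\<Sum>i<d. \<Sum>a<d. x i $ a * ((u \<bullet>c x i) / (x i \<bullet>c x i)) * conjugate (w $ a))"
    by (rule sum.swap)
  also have "\<dots> = (\<Sum>i<d. (u \<bullet>c x i) * (x i \<bullet>c w) / (x i \<bullet>c x i))"
  proof (intro sum.cong refl)
    fix i assume "i \<in> {..<d}"
    have "x i \<bullet>c w = (\<Sum>a<d. x i $ a * conjugate (w $ a))"
      using w by (simp add: scalar_prod_def lessThan_atLeast0)
    thus "(\<Sum>a<d. x i $ a * ((u \<bullet>c x i) / (x i \<bullet>c x i)) * conjugate (w $ a)) =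
        (u \<bullet>c x i) * (x i \<bullet>c w) / (x i \<bullet>c x i)"
      by (simp add: sum_distrib_left sum_divide_distrib mult_ac)
  qed
  finally show ?thesis .
qed

section \<open>Orthonormal families of positive semidefinite matrices\<close>

text \<open>
  The vector \<open>x i\<close> is any nonzero vector in the range of \<open>X i\<close>, which exists because \<open>X i\<close> has norm
  one. Different \<open>X i\<close> annihilate each other by \<open>mat_trace_psd_mult\<close>, and moving \<open>X i\<close> to the
  other side of the inner product turns this into orthogonality of the vectors.
\<close>

lemma psd_orthogonal_range_vectors:
  fixes X :: "nat \<Rightarrow> 'a :: {conjugatable_ordered_field, ordered_comm_ring} mat"
  assumes X: "\<And>i. i < k \<Longrightarrow> psd_mat d (X i)"
    and tr: "\<And>i j. i < k \<Longrightarrow> j < k \<Longrightarrow> trace_inner (X i) (X j) = (if i = j then 1 else 0)"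
  obtains x where "\<And>i. i < k \<Longrightarrow> x i \<in> carrier_vec d"
    and "\<And>i j. i < k \<Longrightarrow> j < k \<Longrightarrow> x i \<bullet>c x j = 0 \<longleftrightarrow> i \<noteq> j"
    and "\<And>i j. i < k \<Longrightarrow> j < k \<Longrightarrow> i \<noteq> j \<Longrightarrow> X i *\<^sub>v x j = 0\<^sub>v d"
proof -
  note c = psd_matD(1,2)[OF X]
  have "\<exists>v. v \<in> carrier_vec d \<and> X i *\<^sub>v v \<noteq> 0\<^sub>v d" if i: "i < k" for i
  proof (rule ccontr)
    assume H: "\<not> ?thesis"
    have "X i = 0\<^sub>m d d"
    proof (rule psd_zero_diag[OF X[OF i]])
      fix a assume a: "a < d"
      hence "X i *\<^sub>v unit_vec d a = 0\<^sub>v d" using H by simp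
      thus "X i $$ (a, a) = 0" using form_unit_vec[OF c(1)[OF i] a] by simp
    qed
    hence "trace_inner (X i) (X i) = 0"
      using c[OF i] by (simp add: trace_inner_def mat_trace_def)
    thus False using tr[OF i i] by simp
  qed
  then obtain v where v: "\<And>i. i < k \<Longrightarrow> v i \<in> carrier_vec d"
    and nz: "\<And>i. i < k \<Longrightarrow> X i *\<^sub>v v i \<noteq> 0\<^sub>v d" by metis
  have XX: "X i * X j = 0\<^sub>m d d" if "i < k" "j < k" "i \<noteq> j" for i j
    using mat_trace_psd_mult[OF X[OF that(2)] X[OF that(1)]] tr[OF that(2,1)] that c(2)[OF that(2)]
    by (simp add: trace_inner_def)
  have ann: "X i *\<^sub>v (X j *\<^sub>v v j) = 0\<^sub>v d" if "i < k" "j < k" "i \<noteq> j" for i j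
    using assoc_mult_mat_vec[OF c(1)[OF that(1)] c(1)[OF that(2)] v[OF that(2)]] XX[OF that]
      v[OF that(2)] by (simp add: zero_mult_mat_vec)
  show ?thesis
  proof (rule that[of "\<lambda>i. X i *\<^sub>v v i"])
    fix i assume i: "i < k"
    show "X i *\<^sub>v v i \<in> carrier_vec d" using c(1)[OF i] v[OF i] by simp
    fix j assume j: "j < k"
    have xj: "X j *\<^sub>v v j \<in> carrier_vec d" using c(1)[OF j] v[OF j] by simp
    show "(X i *\<^sub>v v i) \<bullet>c (X j *\<^sub>v v j) = 0 \<longleftrightarrow> i \<noteq> j"
    proof (cases "i = j")
      case True
      thus ?thesis using nz[OF j] conjugate_square_eq_0_vec[OF xj] by simp
    next
      case False
      thus ?thesis
        using self_adjoint_cscalar[OF c[OF i] v[OF i] xj] ann[OF i j] v[OF i] by simp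
    qed
    show "X i *\<^sub>v (X j *\<^sub>v v j) = 0\<^sub>v d" if "i \<noteq> j" using ann[OF i j that] .
  qed
qed

text \<open>
  In the orthogonal basis of range vectors \<open>y j\<close>, the matrix \<open>X i\<close> kills every \<open>y j\<close> with
  \<open>j \<noteq> i\<close>. Expanding both arguments of its form in this basis leaves one term, which makes \<open>X i\<close> a
  nonnegative multiple \<open>t i\<close> of \<open>y i (y i)\<^sup>T\<close>; the square root of \<open>t i\<close> is absorbed into the vector.
\<close>

lemma psd_orthonormal_rank_one:
  fixes X :: "nat \<Rightarrow> real mat"
  assumes X: "\<And>i. i < d \<Longrightarrow> psd_mat d (X i)"
    and tr: "\<And>i j. i < d \<Longrightarrow> j < d \<Longrightarrow> trace_inner (X i) (X j) = (if i = j then 1 else 0)"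
  obtains x where "\<And>i. i < d \<Longrightarrow> x i \<in> carrier_vec d"
    and "\<And>i. i < d \<Longrightarrow> X i = outer (x i)"
    and "\<And>i j. i < d \<Longrightarrow> j < d \<Longrightarrow> x i \<bullet> x j = (if i = j then 1 else 0)"
proof -
  note c = psd_matD(1,2)[OF X]
  obtain y where y: "\<And>i. i < d \<Longrightarrow> y i \<in> carrier_vec d"
    and orth: "\<And>i j. i < d \<Longrightarrow> j < d \<Longrightarrow> y i \<bullet>c y j = 0 \<longleftrightarrow> i \<noteq> j"
    and ann: "\<And>i j. i < d \<Longrightarrow> j < d \<Longrightarrow> i \<noteq> j \<Longrightarrow> X i *\<^sub>v y j = 0\<^sub>v d"
    using psd_orthogonal_range_vectors[OF X tr] by blast
  define t where "t i = ((X i *\<^sub>v y i) \<bullet>c y i) / (y i \<bullet>c y i)\<^sup>2" for i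
  define x where "x i = sqrt (t i) \<cdot>\<^sub>v y i" for i
  have t: "0 \<le> t i" if "i < d" for i
    using psd_matD(3)[OF X[OF that] y[OF that]] by (simp add: t_def)
  have x: "x i \<in> carrier_vec d" if "i < d" for i
    using y[OF that] by (simp add: x_def)
  have form: "(X i *\<^sub>v u) \<bullet>c w = t i * ((u \<bullet>c y i) * (w \<bullet>c y i))"
    if i: "i < d" and u: "u \<in> carrier_vec d" and w: "w \<in> carrier_vec d" for i u w
  proof -
    have one: "(X i *\<^sub>v u) \<bullet>c w = ((X i *\<^sub>v y i) \<bullet>c u) * (y i \<bullet>c w) / (y i \<bullet>c y i)"
      if u: "u \<in> carrier_vec d" and w: "w \<in> carrier_vec d" for u w
    proof -
      have "(X i *\<^sub>v u) \<bullet>c y j = (X i *\<^sub>v y j) \<bullet>c u" if "j < d" for j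
        using self_adjoint_cscalar[OF c[OF i] u y[OF that]]
          cscalar_conj[OF u mult_mat_vec_carrier[OF c(1)[OF i] y[OF that]]] by simp
      hence "(X i *\<^sub>v u) \<bullet>c w = (\<Sum>j<d. ((X i *\<^sub>v y j) \<bullet>c u) * (y j \<bullet>c w) / (y j \<bullet>c y j))"
        using parseval[OF y orth mult_mat_vec_carrier[OF c(1)[OF i] u] w] by simp
      also have "\<dots> = (\<Sum>j<d. if j = i then ((X i *\<^sub>v y j) \<bullet>c u) * (y j \<bullet>c w) / (y j \<bullet>c y j) else 0)"
        using ann[OF i] u by (intro sum.cong refl) auto
      finally show ?thesis using i by simp
    qed
    have "(X i *\<^sub>v u) \<bullet>c w = ((X i *\<^sub>v y i) \<bullet>c u) * (y i \<bullet>c w) / (y i \<bullet>c y i)"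
      by (rule one[OF u w])
    also have "(X i *\<^sub>v y i) \<bullet>c u = ((X i *\<^sub>v y i) \<bullet>c y i) * (y i \<bullet>c u) / (y i \<bullet>c y i)"
      by (rule one[OF y[OF i] u])
    finally show ?thesis
      using cscalar_conj[OF u y[OF i]] cscalar_conj[OF w y[OF i]]
      by (simp add: t_def power2_eq_square)
  qed
  have Xx: "X i = outer (x i)" if i: "i < d" for i
  proof (rule eq_matI)
    fix a b assume "a < dim_row (outer (x i))" "b < dim_col (outer (x i))"
    hence ab: "a < d" "b < d" using outer_carrier[OF x[OF i]] by auto
    have "X i $$ (a, b) = (X i *\<^sub>v unit_vec d b) \<bullet>c unit_vec d a"
      using c(1)[OF i] ab by simp
    also have "\<dots> = t i * (y i $ b * y i $ a)"
      using form[OF i, of "unit_vec d b" "unit_vec d a"] ab y[OF i] by simp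
    also have "\<dots> = outer (x i) $$ (a, b)"
      using outer_index[OF x[OF i] ab] y[OF i] ab t[OF i] by (simp add: x_def mult_ac)
    finally show "X i $$ (a, b) = outer (x i) $$ (a, b)" .
  qed (use c(1)[OF i] outer_carrier[OF x[OF i]] in auto)
  show ?thesis
  proof (rule that[of x])
    fix i j assume ij: "i < d" "j < d"
    have sq: "(x i \<bullet> x j) * (x i \<bullet> x j) = (if i = j then 1 else 0)"
      using tr[OF ij] trace_inner_outer[OF x[OF ij(1)] x[OF ij(2)]] by (simp add: Xx ij)
    show "x i \<bullet> x j = (if i = j then 1 else 0)"
    proof (cases "i = j")
      case True
      have "0 \<le> x j \<bullet> x j" using conjugate_square_ge_0_vec[of "x j"] by simp
      thus ?thesis using sq True by (simp add: square_eq_1_iff)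
    qed (use sq in simp)
  qed (use x Xx in auto)
qed

section \<open>Factorizations of the matrix and Hadamard matrices\<close>

lemma M_mat_index:
  assumes "i < k + k" "j < k + k"
  shows "M_mat k $$ (i, j) =
    (if i < k \<longleftrightarrow> j < k then if i = j then 1 else 0 else 1 / real k)"
  using assms by (auto simp: M_mat_def all_ones_mat_def)

lemma M_mat_dim: "dim_row (M_mat k) = k + k" "dim_col (M_mat k) = k + k"
  by (simp_all add: M_mat_def all_ones_mat_def)

lemma psd_factorization_M_matD:
  fixes X :: "nat \<Rightarrow> 'a :: {conjugatable_ordered_field, real_algebra_1} mat"
  assumes F: "psd_factorization (M_mat k) d X"
  shows "\<And>i. i < k \<Longrightarrow> psd_mat d (X i)"
    and "\<And>i. i < k \<Longrightarrow> psd_mat d (X (k + i))"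
    and "\<And>i j. i < k \<Longrightarrow> j < k \<Longrightarrow> trace_inner (X i) (X j) = (if i = j then 1 else 0)"
    and "\<And>i j. i < k \<Longrightarrow> j < k \<Longrightarrow> trace_inner (X (k + i)) (X (k + j)) = (if i = j then 1 else 0)"
    and "\<And>i j. i < k \<Longrightarrow> j < k \<Longrightarrow> trace_inner (X i) (X (k + j)) = of_real (1 / real k)"
proof -
  have tr: "trace_inner (X i) (X j) = of_real (M_mat k $$ (i, j))" if "i < k + k" "j < k + k" for i j
    using F that by (simp add: psd_factorization_def M_mat_dim)
  show "psd_mat d (X i)" "psd_mat d (X (k + i))" if "i < k" for i
    using F that by (auto simp: psd_factorization_def M_mat_dim)
  fix i j assume "i < k" "j < k"
  thus "trace_inner (X i) (X j) = (if i = j then 1 else 0)"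
    "trace_inner (X (k + i)) (X (k + j)) = (if i = j then 1 else 0)"
    "trace_inner (X i) (X (k + j)) = of_real (1 / real k)"
    by (simp_all only: tr M_mat_index add_strict_mono trans_less_add1) auto
qed

lemma psd_factorization_M_mat_dim_ge:
  fixes X :: "nat \<Rightarrow> 'a :: {conjugatable_ordered_field, ordered_comm_ring, real_algebra_1} mat"
  assumes F: "psd_factorization (M_mat k) d X"
  shows "k \<le> d"
proof (rule psd_orthogonal_range_vectors[OF psd_factorization_M_matD(1,3)[OF F]])
  fix x :: "nat \<Rightarrow> 'a vec"
  assume "\<And>i. i < k \<Longrightarrow> x i \<in> carrier_vec d"
    and "\<And>i j. i < k \<Longrightarrow> j < k \<Longrightarrow> x i \<bullet>c x j = 0 \<longleftrightarrow> i \<noteq> j"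
  thus "k \<le> d" by (rule orthogonal_family_card_le)
qed

text \<open>
  The trace inner product of \<open>u u\<^sup>*\<close> and \<open>v v\<^sup>*\<close> is the squared modulus of \<open>u \<bullet>c v\<close>. So the
  diagonal blocks come from the orthonormality of the two bases, and the off-diagonal ones from the
  squared moduli of the coordinates of the \<open>u j\<close> in the standard basis.
\<close>

lemma psd_factorization_M_mat_unbiased_basis:
  fixes u :: "nat \<Rightarrow> 'a :: {conjugatable_ordered_field, real_algebra_1} vec"
  assumes u: "\<And>j. j < k \<Longrightarrow> u j \<in> carrier_vec k"
    and orth: "\<And>i j. i < k \<Longrightarrow> j < k \<Longrightarrow> u i \<bullet>c u j = (if i = j then 1 else 0)"
    and unb: "\<And>i j. i < k \<Longrightarrow> j < k \<Longrightarrow> u j $ i * conjugate (u j $ i) = of_real (1 / real k)"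
  shows "psd_factorization (M_mat k) k (\<lambda>i. outer (if i < k then unit_vec k i else u (i - k)))"
proof -
  define w where "w i = (if i < k then unit_vec k i else u (i - k))" for i
  have w: "w i \<in> carrier_vec k" if "i < k + k" for i
    using that u by (auto simp: w_def)
  have entry: "of_real (M_mat k $$ (i, j)) = (w i \<bullet>c w j) * conjugate (w i \<bullet>c w j)"
    if i: "i < k + k" and j: "j < k + k" for i j
  proof -
    consider "i < k" "j < k" | "i < k" "\<not> j < k" | "\<not> i < k" "j < k" | "\<not> i < k" "\<not> j < k"
      by blast
    thus ?thesis
    proof cases
      case 1
      thus ?thesis using i j by (auto simp: w_def M_mat_index)
    next
      case 2
      hence "j - k < k" using j by simp
      with 2 unb[of i "j - k"] u[of "j - k"] show ?thesis
        using i j by (simp add: w_def M_mat_index mult.commute)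
    next
      case 3
      hence "i - k < k" using i by simp
      with 3 unb[of j "i - k"] u[of "i - k"] show ?thesis
        using i j by (simp add: w_def M_mat_index)
    next
      case 4
      hence "i - k < k" "j - k < k" using i j by auto
      with 4 orth[of "i - k" "j - k"] show ?thesis
        using i j by (auto simp: w_def M_mat_index)
    qed
  qed
  have "psd_factorization (M_mat k) k (\<lambda>i. outer (w i))"
    unfolding psd_factorization_def
    using w by (auto simp: M_mat_dim entry trace_inner_outer[OF w w] intro!: psd_mat_outer)
  thus ?thesis by (simp add: w_def)
qed

text \<open>
  The terms are the powers of the quotient of two \<open>k\<close>-th roots of unity. It is again a \<open>k\<close>-th root of
  unity, and it is 1 only for equal roots, so otherwise the geometric sum vanishes.
\<close>

lemma sum_cis_powers:
  assumes "i < k" "j < k"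
  shows "(\<Sum>a<k. cis (2 * pi * real i / real k) ^ a * cnj (cis (2 * pi * real j / real k) ^ a)) =
    (if i = j then of_nat k else 0)"
proof -
  define \<omega> where "\<omega> = (\<lambda>i. cis (2 * pi * real i / real k))"
  have bij: "bij_betw \<omega> {..<k} {z. z ^ k = 1}"
    using bij_betw_roots_unity[of k] assms by (simp add: \<omega>_def)
  have pow: "\<omega> i ^ k = 1" if "i < k" for i
    using bij_betwE[OF bij] that by auto
  have unit: "\<omega> i * cnj (\<omega> i) = 1" for i
    by (simp add: \<omega>_def cis_cnj cis_mult)
  define z where "z = \<omega> i * cnj (\<omega> j)"
  have zk: "z ^ k = 1"
    using pow assms by (simp add: z_def power_mult_distrib flip: complex_cnj_power)
  have "z = 1 \<longleftrightarrow> i = j"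
  proof
    assume "z = 1"
    hence "\<omega> i * (\<omega> j * cnj (\<omega> j)) = \<omega> j" by (simp add: z_def mult_ac)
    hence "\<omega> i = \<omega> j" by (simp add: unit)
    thus "i = j" using bij_betw_imp_inj_on[OF bij] assms by (auto dest: inj_onD)
  qed (simp add: z_def unit)
  moreover have "(\<Sum>a<k. \<omega> i ^ a * cnj (\<omega> j ^ a)) = (\<Sum>a<k. z ^ a)"
    by (simp add: z_def power_mult_distrib)
  moreover have "(\<Sum>a<k. z ^ a) = 0" if "z \<noteq> 1"
    using geometric_sum[OF that, of k] zk by simp
  ultimately show ?thesis by (auto simp: \<omega>_def)
qed

lemma ex_complex_psd_factorization_M_mat:
  assumes "k \<ge> 1"
  shows "\<exists>X :: nat \<Rightarrow> complex mat. psd_factorization (M_mat k) k X"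
proof -
  define u where "u j = vec k (\<lambda>a. cis (2 * pi * real j / real k) ^ a / of_real (sqrt k))" for j
  have sqk: "complex_of_real (sqrt k) * complex_of_real (sqrt k) = of_nat k"
    by (simp flip: of_real_mult)
  have "psd_factorization (M_mat k) k (\<lambda>i. outer (if i < k then unit_vec k i else u (i - k)))"
  proof (rule psd_factorization_M_mat_unbiased_basis)
    fix i j assume ij: "i < k" "j < k"
    have "u i \<bullet>c u j = (\<Sum>a<k. cis (2 * pi * real i / real k) ^ a *
        cnj (cis (2 * pi * real j / real k) ^ a)) / of_nat k"
      by (simp add: u_def scalar_prod_def lessThan_atLeast0 sqk sum_divide_distrib)
    thus "u i \<bullet>c u j = (if i = j then 1 else 0)"
      using assms unfolding sum_cis_powers[OF ij] by auto
    have "cis (2 * pi * real j / real k) ^ i * cnj (cis (2 * pi * real j / real k) ^ i) = 1"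
      by (simp add: cis_cnj cis_mult flip: power_mult_distrib)
    thus "u j $ i * conjugate (u j $ i) = of_real (1 / real k)"
      using ij by (simp add: u_def sqk)
  qed (auto simp: u_def)
  thus ?thesis by blast
qed

lemma ex_real_psd_factorization_if_hadamard:
  assumes H: "hadamard_mat k H" and k: "k \<ge> 1"
  shows "\<exists>X :: nat \<Rightarrow> real mat. psd_factorization (M_mat k) k X"
proof -
  define u where "u j = (1 / sqrt k) \<cdot>\<^sub>v col H j" for j
  have Hc: "H \<in> carrier_mat k k" using H by (simp add: hadamard_mat_def)
  have sq: "H $$ (i, j) * H $$ (i, j) = 1" if "i < k" "j < k" for i j
    using H that by (force simp: hadamard_mat_def)
  have "psd_factorization (M_mat k) k (\<lambda>i. outer (if i < k then unit_vec k i else u (i - k)))"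
  proof (rule psd_factorization_M_mat_unbiased_basis)
    fix i j assume ij: "i < k" "j < k"
    have "col H j \<bullet> col H j = real k"
      using Hc ij sq by (simp add: scalar_prod_def)
    hence "col H i \<bullet> col H j = (if i = j then real k else 0)"
      using H ij by (auto simp: hadamard_mat_def)
    thus "u i \<bullet>c u j = (if i = j then 1 else 0)"
      using Hc k by (simp add: u_def)
    show "u j $ i * conjugate (u j $ i) = of_real (1 / real k)"
      using Hc ij sq[OF ij] k by (simp add: u_def)
  qed (use Hc in \<open>auto simp: u_def\<close>)
  thus ?thesis by blast
qed

text \<open>
  The rows and columns of the Hadamard matrix are indexed by the orthonormal bases \<open>x\<close> and \<open>y\<close>
  behind the two halves of the factorization. Its columns are the coordinates of the \<open>y j\<close> in the
  basis \<open>x\<close>, scaled by \<open>\<surd>k\<close>, so Parseval's identity carries over the orthogonality of the \<open>y j\<close>.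
\<close>

lemma ex_hadamard_if_real_psd_factorization:
  fixes X :: "nat \<Rightarrow> real mat"
  assumes F: "psd_factorization (M_mat k) k X"
  shows "\<exists>H. hadamard_mat k H"
proof -
  note D = psd_factorization_M_matD[OF F]
  obtain x where x: "\<And>i. i < k \<Longrightarrow> x i \<in> carrier_vec k"
    and Xx: "\<And>i. i < k \<Longrightarrow> X i = outer (x i)"
    and xx: "\<And>i j. i < k \<Longrightarrow> j < k \<Longrightarrow> x i \<bullet> x j = (if i = j then 1 else 0)"
    using psd_orthonormal_rank_one[of k X] D(1,3) by blast
  obtain y where y: "\<And>i. i < k \<Longrightarrow> y i \<in> carrier_vec k"
    and Xy: "\<And>i. i < k \<Longrightarrow> X (k + i) = outer (y i)"
    and yy: "\<And>i j. i < k \<Longrightarrow> j < k \<Longrightarrow> y i \<bullet> y j = (if i = j then 1 else 0)"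
    using psd_orthonormal_rank_one[of k "\<lambda>i. X (k + i)"] D(2,4) by blast
  define H where "H = mat k k (\<lambda>(i, j). sqrt k * (x i \<bullet> y j))"
  have Hc: "H \<in> carrier_mat k k" by (simp add: H_def)
  have Hidx: "H $$ (l, i) = sqrt k * (x l \<bullet> y i)" if "l < k" "i < k" for l i
    using that by (simp add: H_def)
  have "hadamard_mat k H"
    unfolding hadamard_mat_def
  proof (intro conjI allI impI)
    fix i j assume ij: "i < k" "j < k"
    have "(x i \<bullet> y j) * (x i \<bullet> y j) = 1 / real k"
      using D(5)[OF ij] trace_inner_outer[OF x[OF ij(1)] y[OF ij(2)]] Xx Xy ij by simp
    hence "(sqrt k * (x i \<bullet> y j)) * (sqrt k * (x i \<bullet> y j)) = 1"
      using ij by (simp add: mult_ac flip: mult.assoc[of "sqrt k" "sqrt k"])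
    thus "H $$ (i, j) \<in> {-1, 1}"
      using ij by (auto simp: H_def square_eq_1_iff)
    assume "i \<noteq> j"
    have "col H i \<bullet> col H j = (\<Sum>l<k. (sqrt k * (x l \<bullet> y i)) * (sqrt k * (x l \<bullet> y j)))"
      using ij Hc Hidx by (simp add: scalar_prod_def[of "col H i"] lessThan_atLeast0)
    also have "\<dots> = (\<Sum>l<k. real k * ((y i \<bullet> x l) * (x l \<bullet> y j)))"
    proof (intro sum.cong refl)
      fix l assume "l \<in> {..<k}"
      hence "x l \<bullet> y i = y i \<bullet> x l" using x y ij by (intro comm_scalar_prod[of _ k]) auto
      thus "(sqrt k * (x l \<bullet> y i)) * (sqrt k * (x l \<bullet> y j)) = real k * ((y i \<bullet> x l) * (x l \<bullet> y j))"
        by (simp add: mult_ac flip: mult.assoc[of "sqrt k" "sqrt k"])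
    qed
    also have "\<dots> = real k * (y i \<bullet> y j)"
      using parseval[of k x "y i" "y j"] x xx y ij by (simp add: sum_distrib_left)
    also have "\<dots> = 0" using yy ij \<open>i \<noteq> j\<close> by simp
    finally show "col H i \<bullet> col H j = 0" .
  qed (auto simp: H_def)
  thus ?thesis by blast
qed

section \<open>The two ranks\<close>

lemma Inf_enat_eq_iff:
  assumes "\<And>d. P d \<Longrightarrow> k \<le> d"
  shows "Inf {enat d | d. P d} = enat k \<longleftrightarrow> P k"
proof
  assume eq: "Inf {enat d | d. P d} = enat k"
  have "{enat d | d. P d} \<noteq> {}"
  proof
    assume "{enat d | d. P d} = {}"
    from eq[unfolded this] show False by (simp add: Inf_enat_def)
  qed
  hence "Inf {enat d | d. P d} \<in> {enat d | d. P d}" 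
    by (metis (no_types, lifting) all_not_in_conv wellorder_InfI)
  thus "P k" using eq by auto
next
  assume "P k"
  thus "Inf {enat d | d. P d} = enat k"
    using assms by (intro antisym Inf_lower Inf_greatest) auto
qed

theorem proposition2p3:
  fixes k :: nat
  assumes "k \<ge> 1"
  shows "cpsd_rank_complex (M_mat k) = enat k \<and>
    (cpsd_rank_real (M_mat k) = enat k \<longleftrightarrow> (\<exists>H. hadamard_mat k H))"
proof
  show "cpsd_rank_complex (M_mat k) = enat k"
    unfolding cpsd_rank_complex_def
    by (subst Inf_enat_eq_iff) (auto intro: psd_factorization_M_mat_dim_ge ex_complex_psd_factorization_M_mat assms)
  have "cpsd_rank_real (M_mat k) = enat k \<longleftrightarrow> (\<exists>X :: nat \<Rightarrow> real mat. psd_factorization (M_mat k) k X)"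
    unfolding cpsd_rank_real_def
    by (rule Inf_enat_eq_iff) (auto intro: psd_factorization_M_mat_dim_ge)
  thus "cpsd_rank_real (M_mat k) = enat k \<longleftrightarrow> (\<exists>H. hadamard_mat k H)"
    using ex_real_psd_factorization_if_hadamard[OF _ assms] ex_hadamard_if_real_psd_factorization by blast
qed

end
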